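(* Let $k\ge 3$ be an integer and let $(\{e\},\rho)$ be a $k$-polymatroid on a one-element ground set, of rank $m=\rho(\{e\})$. (1) If $m\in\{0,1,k-1,k\}$, then $\rho\in\mathcal{P}_{U_{2,4}}^k$ and hence $\rho$ is not an excluded minor for $\mathcal{P}_{U_{2,4}}^k$. (2) If $2\le m\le k-2$, then $\rho$ is an excluded minor for $\mathcal{P}_{U_{2,4}}^k$.
   Context: A polymatroid is a pair $(E,\rho)$ where $E$ is a finite set and $\rho:2^E\to\mathbb{Z}$ satisfies $\rho(\emptyset)=0$, monotonicity and submodularity ($\rho(A)+\rho(B)\ge\rho(A\cap B)+\rho(A\cup B)$). For an integer $k\ge 1$, a $k$-polymatroid is a polymatroid with $\rho(\{e\})\le k$ for all $e\in E$. For $X\subseteq E$, the deletion $\rho\backslash X$ and contraction $\rho/X$ are the polymatroids on $E-X$ given by $(\rho\backslash X)(Y)=\rho(Y)$ and $(\rho/X)(Y)=\rho(X\cup Y)-\rho(X)$. A minor of $\rho$ is a polymatroid $(\rho\backslash X)/Y$ with $X,Y\subseteq E$ disjoint; it is proper if $X\cup Y\ne\emptyset$. The $k$-natural matroid $M_\rho^k$ of a $k$-polymatroid $(E,\rho)$: for each $e\in E$ let $X_e$ be a set of $k$ elements, with $X_e\cap X_f=\emptyset$ for $e\neq f$; for $A\subseteq E$ let $X_A=\bigcup_{e\in A}X_e$. Then $M_\rho^k$ is the matroid on $X_E$ with rank function $r(X)=\min\{\rho(A)+|X-X_A| : A\subseteq E\}$. $\mathcal{P}_{U_{2,4}}^k$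 denotes the class of $k$-polymatroids whose $k$-natural matroid is binary (representable over $\mathbb{F}_2$). An excluded minor for $\mathcal{P}_{U_{2,4}}^k$ is a $k$-polymatroid that is not in $\mathcal{P}_{U_{2,4}}^k$ but all of whose proper minors are in $\mathcal{P}_{U_{2,4}}^k$. *)

theory Defs
  imports Complex_Main "HOL-Library.Z2" "HOL-Library.Function_Algebras"
begin

text \<open>A polymatroid is a pair of a finite ground set and an integer-valued set function.
  Only the values on subsets of the ground set are constrained or used.\<close>

type_synonym 'a ranked = "'a set \<times> ('a set \<Rightarrow> int)"

fun polymatroid :: "'a ranked \<Rightarrow> bool" where
  "polymatroid (E, \<rho>) \<longleftrightarrow>
     finite E \<and> \<rho> {} = 0 \<and>
     (\<forall>A B. A \<subseteq> B \<and> B \<subseteq> E \<longrightarrow> \<rho> A \<le> \<rho> B) \<and>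
     (\<forall>A B. A \<subseteq> E \<and> B \<subseteq> E \<longrightarrow> \<rho> A + \<rho> B \<ge> \<rho> (A \<inter> B) + \<rho> (A \<union> B))"

fun k_polymatroid :: "nat \<Rightarrow> 'a ranked \<Rightarrow> bool" where
  "k_polymatroid k (E, \<rho>) \<longleftrightarrow> polymatroid (E, \<rho>) \<and> (\<forall>e\<in>E. \<rho> {e} \<le> int k)"

text \<open>Matroids, given by their rank functions, are exactly the 1-polymatroids.\<close>

abbreviation matroid :: "'a ranked \<Rightarrow> bool" where
  "matroid \<equiv> k_polymatroid 1"

fun deletion :: "'a ranked \<Rightarrow> 'a set \<Rightarrow> 'a ranked" where
  "deletion (E, \<rho>) X = (E - X, \<rho>)"

fun contraction :: "'a ranked \<Rightarrow> 'a set \<Rightarrow> 'a ranked" where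
  "contraction (E, \<rho>) X = (E - X, \<lambda>Y. \<rho> (X \<union> Y) - \<rho> X)"

definition proper_minor :: "'a ranked \<Rightarrow> 'a ranked \<Rightarrow> bool" where
  "proper_minor Q P \<longleftrightarrow>
     (\<exists>X Y. X \<subseteq> fst P \<and> Y \<subseteq> fst P \<and> X \<inter> Y = {} \<and> X \<union> Y \<noteq> {} \<and>
            Q = contraction (deletion P X) Y)"

text \<open>The set \<open>clones k A\<close> is $X_A$, with the concrete choice $X_e = \{e\} \times \{0,\dots,k-1\}$.\<close>

definition clones :: "nat \<Rightarrow> 'a set \<Rightarrow> ('a \<times> nat) set" where
  "clones k A = A \<times> {..<k}"

fun natural_matroid :: "nat \<Rightarrow> 'a ranked \<Rightarrow> ('a \<times> nat) ranked" where
  "natural_matroid k (E, \<rho>) =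
     (clones k E, \<lambda>X. Min {\<rho> A + int (card (X - clones k A)) | A. A \<subseteq> E})"

definition coord_scale :: "'f::field \<Rightarrow> (nat \<Rightarrow> 'f) \<Rightarrow> (nat \<Rightarrow> 'f)" where
  "coord_scale c v = (\<lambda>i. c * v i)"

interpretation coord: vector_space "coord_scale :: 'f::field \<Rightarrow> _"
  by unfold_locales (auto simp: coord_scale_def algebra_simps)

text \<open>Representability over a field: there is a matrix with finitely many rows, say \<open>d\<close>, and
  with columns \<open>v x\<close> indexed by the ground set (vectors in $F^d$ are functions vanishing from
  index \<open>d\<close> on), such that the rank of each set is the dimension spanned by its columns.\<close>

fun representable :: "'f::field itself \<Rightarrow> 'a ranked \<Rightarrow> bool" where
  "representable (_ :: 'f itself) (E, r) \<longleftrightarrow>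
     matroid (E, r) \<and>
     (\<exists>(d::nat) (v :: 'a \<Rightarrow> nat \<Rightarrow> 'f).
        (\<forall>x\<in>E. \<forall>i\<ge>d. v x i = 0) \<and>
        (\<forall>X. X \<subseteq> E \<longrightarrow> r X = int (coord.dim (v ` X))))"

definition binary :: "'a ranked \<Rightarrow> bool" where
  "binary M \<longleftrightarrow> representable TYPE(bit) M"

text \<open>The class $\mathcal{P}_{U_{2,4}}^k$.\<close>

definition P_U24 :: "nat \<Rightarrow> 'a ranked set" where
  "P_U24 k = {P. k_polymatroid k P \<and> binary (natural_matroid k P)}"

definition excluded_minor_P_U24 :: "nat \<Rightarrow> 'a ranked \<Rightarrow> bool" where
  "excluded_minor_P_U24 k P \<longleftrightarrow>
     k_polymatroid k P \<and> P \<notin> P_U24 k \<and> (\<forall>Q. proper_minor Q P \<longrightarrow> Q \<in> P_U24 k)"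

end

theory Submission
  imports Defs
begin

text \<open>
  The natural matroid of a polymatroid on one element \<open>e\<close> of rank \<open>m\<close> lives on the \<open>k\<close> clones of
  \<open>e\<close>, and the minimum defining its rank has only the two candidates \<open>A = {}\<close> and \<open>A = {e}\<close>; hence
  it is the uniform matroid $U_{m,k}$ (\<open>natural_matroid_singleton\<close>). A proper minor has an empty
  ground set and is always in the class (\<open>empty_mem_P_U24\<close>). So everything rests on
  the fact that $U_{m,n}$ is binary iff \<open>m \<le> 1\<close> or \<open>n \<le> m + 1\<close> (\<open>binary_uniform_iff\<close>).

  Over $F_2$ every nonzero coefficient is 1, so a family of vectors is independent iff no nonempty
  subfamily sums to zero (\<open>dim_eq_card_iff_no_zero_sum\<close>). If $U_{m,n}$ with \<open>m \<ge> 2\<close> and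
  \<open>n \<ge> m + 2\<close> were binary, take an \<open>m\<close>-set \<open>S\<close> and further elements \<open>a\<close>, \<open>b\<close>.
  All \<open>m\<close>-subsets of \<open>S \<union> {a}\<close> are independent, so the only possible zero sum is that of the
  whole circuit; thus \<open>v a\<close> is the sum of \<open>v\<close> over \<open>S\<close>, and likewise \<open>v b\<close>. Then \<open>v a + v b = 0\<close>, although the
  pair \<open>{a, b}\<close> is independent because \<open>m \<ge> 2\<close>. Conversely, the unit vectors of
  $F_2^m$, together with the all-ones vector for every remaining element, represent $U_{m,n}$ in the
  other cases.
\<close>

section \<open>Dimension of finite families of vectors\<close>

lemma sum_fun_apply:
  "(\<Sum>x\<in>X. (f x :: 'i \<Rightarrow> 'b::comm_monoid_add)) i = (\<Sum>x\<in>X. f x i)"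
  by (induction X rule: infinite_finite_induct) auto

lemma dim_le_of_vanishing:
  fixes V :: "(nat \<Rightarrow> 'f::field) set"
  assumes "\<And>w i. w \<in> V \<Longrightarrow> i \<ge> d \<Longrightarrow> w i = 0"
  shows "coord.dim V \<le> d"
proof -
  define unit :: "nat \<Rightarrow> nat \<Rightarrow> 'f" where "unit = (\<lambda>j i. if i = j then 1 else 0)"
  have "w \<in> coord.span (unit ` {..<d})" if "w \<in> V" for w
  proof -
    have "w i = (\<Sum>j<d. coord_scale (w j) (unit j)) i" for i
    proof -
      have "(\<Sum>j<d. coord_scale (w j) (unit j)) i = (\<Sum>j<d. if j = i then w j else 0)"
        unfolding sum_fun_apply by (intro sum.cong) (auto simp: coord_scale_def unit_def)
      also have "\<dots> = w i"
        using assms[OF that, of i] by (simp add: not_less)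
      finally show ?thesis by simp
    qed
    then have "w = (\<Sum>j<d. coord_scale (w j) (unit j))" by blast
    also have "\<dots> \<in> coord.span (unit ` {..<d})"
      by (intro coord.span_sum coord.span_scale coord.span_base) auto
    finally show ?thesis .
  qed
  then have "coord.dim V \<le> card (unit ` {..<d})"
    by (intro coord.dim_le_card) auto
  also have "\<dots> \<le> d"
    using card_image_le[of "{..<d}" unit] by simp
  finally show ?thesis .
qed

text \<open>In the infinite-dimensional space of all coordinate sequences an infinite basis has
  cardinality 0, so the dimension is monotone only below sets of finite rank.\<close>

lemma dim_mono_finite:
  fixes W :: "(nat \<Rightarrow> 'f::field) set"
  assumes "finite W" "V \<subseteq> W"
  shows "coord.dim V \<le> coord.dim W"
proof -
  obtain B where B: "B \<subseteq> W" "W \<subseteq> coord.span B" "card B = coord.dim W"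
    by (rule coord.basis_exists)
  have "finite B" using B(1) assms(1) finite_subset by blast
  then show ?thesis
    using coord.dim_le_card[of V B] assms(2) B by auto
qed

text \<open>The only nonzero coefficient over $F_2$ is 1, so a linear relation amounts to the set of
  indices on which its coefficients are nonzero. Repeated vectors are covered as well: two
  equal ones already have sum zero.\<close>

lemma dim_eq_card_iff_no_zero_sum:
  fixes v :: "'a \<Rightarrow> nat \<Rightarrow> bit"
  assumes X: "finite X"
  shows "coord.dim (v ` X) = card X \<longleftrightarrow> (\<forall>Y\<subseteq>X. Y \<noteq> {} \<longrightarrow> sum v Y \<noteq> 0)"
proof
  assume dim: "coord.dim (v ` X) = card X"
  obtain B where B: "B \<subseteq> v ` X" "coord.independent B" "card B = coord.dim (v ` X)"
    by (rule coord.basis_exists)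
  have card: "card (v ` X) = card X"
    using card_image_le[OF X, of v] coord.dim_le_card'[of "v ` X"] X dim by simp
  then have inj: "inj_on v X" using X by (simp add: eq_card_imp_inj_on)
  have "B = v ` X" using B card dim X by (intro card_subset_eq) auto
  with B have indep: "coord.independent (v ` X)" by simp
  show "\<forall>Y\<subseteq>X. Y \<noteq> {} \<longrightarrow> sum v Y \<noteq> 0"
  proof (intro allI impI notI)
    fix Y assume Y: "Y \<subseteq> X" "Y \<noteq> {}" "sum v Y = 0"
    have "(\<Sum>w\<in>v ` Y. coord_scale 1 w) = sum v Y"
      using inj_on_subset[OF inj Y(1)] by (simp add: sum.reindex)
    then have "(\<Sum>w\<in>v ` Y. coord_scale 1 w) = 0" using Y(3) by (rule trans)
    moreover have "finite (v ` Y)" "v ` Y \<subseteq> v ` X" "\<exists>w\<in>v ` Y. (1::bit) \<noteq> 0"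
      using Y(1,2) finite_subset[OF Y(1) X] by auto
    ultimately have "coord.dependent (v ` X)"
      unfolding coord.dependent_explicit
      by (intro exI[of _ "v ` Y"] exI[of _ "\<lambda>_. 1 :: bit"] conjI)
    with indep show False by simp
  qed
next
  assume nz: "\<forall>Y\<subseteq>X. Y \<noteq> {} \<longrightarrow> sum v Y \<noteq> 0"
  have inj: "inj_on v X"
  proof (rule inj_onI, rule ccontr)
    fix x y assume xy: "x \<in> X" "y \<in> X" "v x = v y" "x \<noteq> y"
    then have "sum v {x, y} = 0" by (auto simp: fun_eq_iff)
    then show False using nz[rule_format, of "{x, y}"] xy(1,2) by simp
  qed
  have "coord.independent (v ` X)"
  proof
    assume "coord.dependent (v ` X)"
    then obtain u where u: "\<exists>w\<in>v ` X. u w \<noteq> 0" "(\<Sum>w\<in>v ` X. coord_scale (u w) w) = 0"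
      using X coord.dependent_finite[of "v ` X"] by auto
    define Y where "Y = {x \<in> X. u (v x) \<noteq> 0}"
    have "sum v Y = (\<Sum>x\<in>X. coord_scale (u (v x)) (v x))"
      unfolding Y_def using X
      by (intro sum.mono_neutral_cong_left) (auto simp: coord_scale_def fun_eq_iff)
    also have "\<dots> = 0" using u(2) inj by (simp add: sum.reindex)
    finally have "sum v Y = 0" .
    moreover have "Y \<subseteq> X" "Y \<noteq> {}" using u(1) by (auto simp: Y_def)
    ultimately show False using nz by blast
  qed
  then show "coord.dim (v ` X) = card X"
    using inj by (simp add: coord.dim_eq_card_independent card_image)
qed

section \<open>Binary uniform matroids\<close>

lemma uniform_matroid:
  assumes "finite E" and r: "\<And>X. X \<subseteq> E \<Longrightarrow> r X = int (min (card X) m)"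
  shows "matroid (E, r)"
proof -
  have "r A \<le> r B" if "A \<subseteq> B" "B \<subseteq> E" for A B
  proof -
    have "card A \<le> card B" using that assms(1) by (meson card_mono finite_subset)
    then show ?thesis using that r[of A] r[of B] by auto
  qed
  moreover have "r (A \<inter> B) + r (A \<union> B) \<le> r A + r B" if "A \<subseteq> E" "B \<subseteq> E" for A B
  proof -
    have fin: "finite A" "finite B" using that assms(1) finite_subset by blast+
    have "card (A \<inter> B) \<le> card A" "card (A \<inter> B) \<le> card B"
      using fin by (auto intro: card_mono)
    moreover have "card A + card B = card (A \<union> B) + card (A \<inter> B)"
      using fin by (rule card_Un_Int)
    moreover have "r (A \<inter> B) = int (min (card (A \<inter> B)) m)"
      "r (A \<union> B) = int (min (card (A \<union> B)) m)"
      using that by (auto intro!: r)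
    ultimately show ?thesis using r[OF that(1)] r[OF that(2)] by linarith
  qed
  moreover have "r {} = 0" using r[of "{}"] by simp
  moreover have "r {x} \<le> 1" if "x \<in> E" for x using r[of "{x}"] that by simp
  ultimately show ?thesis unfolding k_polymatroid.simps polymatroid.simps using assms(1) by simp
qed

text \<open>If \<open>X\<close> has at most \<open>m\<close> elements its vectors are independent; if it has more, it contains
  \<open>m\<close> independent vectors and lives in an \<open>m\<close>-dimensional space.\<close>

lemma binary_uniformI:
  fixes v :: "'a \<Rightarrow> nat \<Rightarrow> bit"
  assumes E: "finite E" and r: "\<And>X. X \<subseteq> E \<Longrightarrow> r X = int (min (card X) m)"
    and vanish: "\<And>x i. x \<in> E \<Longrightarrow> i \<ge> m \<Longrightarrow> v x i = 0"
    and nz: "\<And>Y. Y \<subseteq> E \<Longrightarrow> Y \<noteq> {} \<Longrightarrow> card Y \<le> m \<Longrightarrow> sum v Y \<noteq> 0"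
  shows "binary (E, r)"
proof -
  have indep: "coord.dim (v ` X) = card X" if "X \<subseteq> E" "card X \<le> m" for X
  proof -
    have X: "finite X" using that(1) E finite_subset by blast
    have "sum v Y \<noteq> 0" if "Y \<subseteq> X" "Y \<noteq> {}" for Y
      using nz[of Y] that \<open>X \<subseteq> E\<close> \<open>card X \<le> m\<close> card_mono[OF X \<open>Y \<subseteq> X\<close>] by auto
    then show ?thesis using dim_eq_card_iff_no_zero_sum[OF X] by blast
  qed
  have "coord.dim (v ` X) = min (card X) m" if X: "X \<subseteq> E" for X
  proof (cases "card X \<le> m")
    case True
    then show ?thesis using indep[OF X] by simp
  next
    case False
    then obtain T where T: "T \<subseteq> X" "card T = m"
      using obtain_subset_with_card_n[of m X] by auto
    have "finite X" using X E finite_subset by blast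
    then have "m \<le> coord.dim (v ` X)"
      using indep[of T] T X dim_mono_finite[of "v ` X" "v ` T"] by auto
    moreover have "coord.dim (v ` X) \<le> m"
      using X vanish by (intro dim_le_of_vanishing) auto
    ultimately show ?thesis using False by simp
  qed
  then show ?thesis
    unfolding binary_def representable.simps
    using uniform_matroid[OF E r] r vanish by (intro conjI exI[of _ m] exI[of _ v]) auto
qed

text \<open>The representation numbers the ground set by \<open>0, \<dots>, n - 1\<close>. For \<open>n \<le> m + 1\<close> at most
  one element carries the all-ones vector. For \<open>m = 1\<close> that vector is the only unit vector, so all
  elements become parallel, as they should be.\<close>

lemma binary_uniform:
  assumes E: "finite E" and r: "\<And>X. X \<subseteq> E \<Longrightarrow> r X = int (min (card X) m)"
    and m: "m \<le> 1 \<or> card E \<le> m + 1"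
  shows "binary (E, r)"
proof -
  obtain idx where idx: "bij_betw idx E {0..<card E}"
    using ex_bij_betw_finite_nat[OF E] by blast
  define v :: "'a \<Rightarrow> nat \<Rightarrow> bit"
    where "v = (\<lambda>x j. if j < m \<and> (idx x = j \<or> m \<le> idx x) then 1 else 0)"
  show ?thesis
  proof (rule binary_uniformI[where v = v, OF E r])
    show "v x i = 0" if "i \<ge> m" for x i using that by (simp add: v_def)
  next
    fix Y assume Y: "Y \<subseteq> E" "Y \<noteq> {}" "card Y \<le> m"
    have finY: "finite Y" using Y(1) E finite_subset by blast
    have inj: "inj_on idx Y" using idx Y(1) by (auto simp: bij_betw_def inj_on_subset)
    \<comment> \<open>A coordinate in which exactly one vector of \<open>Y\<close> is 1 shows that the sum is nonzero.\<close>
    have single: "sum v Y \<noteq> 0" if "x \<in> Y" "v x j = 1" "\<And>y. y \<in> Y \<Longrightarrow> y \<noteq> x \<Longrightarrow> v y j = 0" for x j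
    proof -
      have "(\<Sum>y\<in>Y. v y j) = (\<Sum>y\<in>Y. if y = x then 1 else 0)"
        using that by (intro sum.cong) auto
      then have "sum v Y j = 1" using that(1) finY by (simp add: sum_fun_apply)
      then show ?thesis by auto
    qed
    have "card Y > 0" using Y finY by (simp add: card_gt_0_iff)
    then have "m > 0" using Y(3) by simp
    consider (one) "m = 1" | (unit) "\<forall>y\<in>Y. idx y < m"
      | (ones) x where "m \<noteq> 1" "x \<in> Y" "m \<le> idx x" by (meson not_less)
    then show "sum v Y \<noteq> 0"
    proof cases
      case one
      then have "card Y = 1" using Y(3) \<open>card Y > 0\<close> by simp
      then obtain x where x: "Y = {x}" by (auto simp: card_1_singleton_iff)
      show ?thesis by (rule single[of x 0]) (auto simp: x v_def one)
    next
      case unit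
      obtain x where x: "x \<in> Y" using Y(2) by blast
      show ?thesis
      proof (rule single[OF x, of "idx x"])
        show "v x (idx x) = 1" using unit x by (simp add: v_def)
        show "v y (idx x) = 0" if "y \<in> Y" "y \<noteq> x" for y
          using unit that x inj by (auto simp: v_def inj_on_def)
      qed
    next
      case ones
      have "card E \<le> m + 1" using m ones(1) \<open>m > 0\<close> by auto
      have lt: "idx y < card E" if "y \<in> Y" for y
        using bij_betwE[OF idx] Y(1) that by force
      have only: "idx y < m" if "y \<in> Y" "y \<noteq> x" for y
      proof -
        have "idx y \<noteq> idx x" using inj that ones(2) by (meson inj_onD)
        then show ?thesis using \<open>card E \<le> m + 1\<close> lt[OF that(1)] lt[OF ones(2)] ones(3) by linarith
      qed
      have "card (idx ` (Y - {x})) < m"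
        using card_image_le[of "Y - {x}" idx] finY ones(2) Y(3) \<open>card Y > 0\<close> by auto
      then have "\<not> {..<m} \<subseteq> idx ` (Y - {x})"
        using card_mono[of "idx ` (Y - {x})" "{..<m}"] finY by auto
      then obtain j where j: "j < m" "\<forall>y\<in>Y - {x}. idx y \<noteq> j" by auto
      show ?thesis
      proof (rule single[OF ones(2), of j])
        show "v x j = 1" using j ones by (simp add: v_def)
        show "v y j = 0" if "y \<in> Y" "y \<noteq> x" for y
          using j only[OF that] that by (auto simp: v_def)
      qed
    qed
  qed
qed

text \<open>Two elements outside a common basis \<open>S\<close> would both be represented by the sum over \<open>S\<close> and hence be
  parallel, which rank at least 2 forbids.\<close>

lemma binary_uniform_bound:
  assumes E: "finite E" and r: "\<And>X. X \<subseteq> E \<Longrightarrow> r X = int (min (card X) m)"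
    and bin: "binary (E, r)" and m: "m \<ge> 2"
  shows "card E \<le> m + 1"
proof (rule ccontr)
  assume "\<not> card E \<le> m + 1"
  then obtain T where T: "T \<subseteq> E" "card T = m + 2"
    using obtain_subset_with_card_n[of "m + 2" E] by auto
  have "card T = Suc (m + 1)" using T(2) by simp
  then obtain a T' where a: "T = insert a T'" "a \<notin> T'" "card T' = Suc m"
    unfolding card_Suc_eq[of T] by auto
  then obtain b S where b: "T' = insert b S" "b \<notin> S" "card S = m"
    unfolding card_Suc_eq[of T'] by blast
  have S: "S \<subseteq> E" using T(1) a(1) b(1) by simp
  then have finS: "finite S" using E finite_subset by blast
  have ab: "a \<in> E" "b \<in> E" "a \<noteq> b" "a \<notin> S" using T(1) a(1,2) b(1) by auto
  obtain v :: "'a \<Rightarrow> nat \<Rightarrow> bit" where v: "\<And>X. X \<subseteq> E \<Longrightarrow> r X = int (coord.dim (v ` X))"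
    using bin unfolding binary_def representable.simps by blast
  have dim: "coord.dim (v ` X) = min (card X) m" if "X \<subseteq> E" for X
    using v[OF that] r[OF that] by simp
  have nz: "sum v Y \<noteq> 0" if "Y \<subseteq> E" "Y \<noteq> {}" "card Y \<le> m" for Y
    using dim_eq_card_iff_no_zero_sum[of Y v] dim[of Y] that E finite_subset by fastforce
  \<comment> \<open>Each of \<open>a\<close>, \<open>b\<close> completes \<open>S\<close> to a circuit, whose unique relation is the sum of all its vectors.\<close>
  have circuit: "sum v (insert x S) = 0" if x: "x \<in> E" "x \<notin> S" for x
  proof -
    have fin: "finite (insert x S)" and card: "card (insert x S) = m + 1"
      using finS b x by simp_all
    have "coord.dim (v ` insert x S) \<noteq> card (insert x S)"
      unfolding card using dim[of "insert x S"] x S card by simp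
    then obtain Y where Y: "Y \<subseteq> insert x S" "Y \<noteq> {}" "sum v Y = 0"
      using dim_eq_card_iff_no_zero_sum[OF fin] by blast
    have "\<not> card Y \<le> m" using nz[of Y] Y x(1) S by (meson insert_subset subset_trans)
    then have "Y = insert x S" using Y(1) fin card by (intro card_seteq) auto
    then show ?thesis using Y(3) by (simp only:)
  qed
  have "v a + sum v S = 0" "v b + sum v S = 0"
    using circuit[OF ab(1,4)] circuit[OF ab(2) b(2)]
    unfolding sum.insert[OF finS ab(4)] sum.insert[OF finS b(2)] .
  then have "v a = v b" by (metis add_right_cancel)
  then have "sum v {a, b} = 0" using ab by (auto simp: fun_eq_iff)
  then show False using nz[of "{a, b}"] ab m by auto
qed

lemma binary_uniform_iff:
  assumes "finite E" and "\<And>X. X \<subseteq> E \<Longrightarrow> r X = int (min (card X) m)"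
  shows "binary (E, r) \<longleftrightarrow> m \<le> 1 \<or> card E \<le> m + 1"
  using binary_uniform[OF assms] binary_uniform_bound[OF assms] by fastforce

section \<open>Polymatroids on at most one element\<close>

lemma natural_matroid_singleton:
  assumes "\<rho> {} = 0" "\<rho> {e} = int m" "X \<subseteq> clones k {e}"
  shows "snd (natural_matroid k ({e}, \<rho>)) X = int (min (card X) m)"
proof -
  have "{\<rho> A + int (card (X - clones k A)) |A. A \<subseteq> {e}}
      = (\<lambda>A. \<rho> A + int (card (X - clones k A))) ` {{}, {e}}"
    by (auto simp: subset_singleton_iff)
  also have "\<dots> = {int (card X), int m}"
    using assms by (auto simp: clones_def Diff_eq_empty_iff[THEN iffD2])
  finally show ?thesis by simp
qed

lemma singleton_mem_P_U24_iff:
  assumes k: "k_polymatroid k ({e}, \<rho>)" and m: "\<rho> {e} = int m"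
  shows "({e}, \<rho>) \<in> P_U24 k \<longleftrightarrow> m \<le> 1 \<or> k \<le> m + 1"
proof -
  have "\<rho> {} = 0" using k by simp
  note rank = natural_matroid_singleton[OF this m]
  have eq: "natural_matroid k ({e}, \<rho>) = (clones k {e}, snd (natural_matroid k ({e}, \<rho>)))"
    by simp
  have "finite (clones k {e})" "card (clones k {e}) = k"
    by (auto simp: clones_def card_cartesian_product)
  then have "binary (natural_matroid k ({e}, \<rho>)) \<longleftrightarrow> m \<le> 1 \<or> k \<le> m + 1"
    using binary_uniform_iff[OF _ rank] by (subst eq) simp
  then show ?thesis using k by (simp add: P_U24_def)
qed

lemma empty_mem_P_U24:
  assumes "\<rho> {} = 0"
  shows "({}, \<rho>) \<in> P_U24 k"
proof -
  have nat: "natural_matroid k ({}, \<rho>) = ({}, snd (natural_matroid k ({}, \<rho>)))"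
    by (simp add: clones_def)
  have "binary ({}, snd (natural_matroid k ({}, \<rho>)))"
    by (rule binary_uniform[where m = 0]) (auto simp: assms clones_def)
  then have "binary (natural_matroid k ({}, \<rho>))" by (subst nat)
  then show ?thesis using assms by (auto simp: P_U24_def)
qed

lemma proper_minor_singleton_mem_P_U24:
  assumes "\<rho> {} = 0" "proper_minor Q ({e}, \<rho>)"
  shows "Q \<in> P_U24 k"
proof -
  obtain X Y where XY: "X \<subseteq> {e}" "Y \<subseteq> {e}" "X \<union> Y \<noteq> {}"
    and Q: "Q = contraction (deletion ({e}, \<rho>) X) Y"
    using assms(2) unfolding proper_minor_def by auto
  have "{e} - X - Y = {}" using XY by auto
  then have "Q = ({}, \<lambda>Z. \<rho> (Y \<union> Z) - \<rho> Y)" using Q by simp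
  then show ?thesis by (simp add: empty_mem_P_U24)
qed

theorem theorem3p0p1:
  fixes k :: nat and e :: 'a and \<rho> :: "'a set \<Rightarrow> int" and m :: int
  assumes "k \<ge> 3"
    and "k_polymatroid k ({e}, \<rho>)"
    and "m = \<rho> {e}"
  shows "(m \<in> {0, 1, int k - 1, int k} \<longrightarrow>
            ({e}, \<rho>) \<in> P_U24 k \<and> \<not> excluded_minor_P_U24 k ({e}, \<rho>)) \<and>
         (2 \<le> m \<and> m \<le> int k - 2 \<longrightarrow> excluded_minor_P_U24 k ({e}, \<rho>))"
proof -
  have "\<rho> {} = 0" using assms(2) by simp
  moreover have "\<rho> {} \<le> \<rho> {e}"
    using assms(2) unfolding k_polymatroid.simps polymatroid.simps by blast
  ultimately obtain n where n: "m = int n" using assms(3) nonneg_int_cases by metis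
  have mem: "({e}, \<rho>) \<in> P_U24 k \<longleftrightarrow> n \<le> 1 \<or> k \<le> n + 1"
    using singleton_mem_P_U24_iff[OF assms(2)] assms(3) n by simp
  have exm: "excluded_minor_P_U24 k ({e}, \<rho>) \<longleftrightarrow> ({e}, \<rho>) \<notin> P_U24 k"
    unfolding excluded_minor_P_U24_def
    using assms(2) proper_minor_singleton_mem_P_U24[of \<rho>] \<open>\<rho> {} = 0\<close> by blast
  show ?thesis unfolding exm mem n by auto
qed

end
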